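(* Let $f \colon \mathbb{C} \rightarrow \mathbb{C}$ be a cubic polynomial map with symmetries such that the multiplier of $f$ at each of its cycles is an integer. Then $f$ is a power map or a Chebyshev map.
   Context: A point $z_0 \in \mathbb{C}$ is periodic for a polynomial map $f \colon \mathbb{C} \to \mathbb{C}$ if $f^{\circ n}(z_0) = z_0$ for some integer $n \geq 1$; the least such $n$ is its period, and its forward orbit (which has cardinality $n$) is called a cycle. The multiplier of $f$ at $z_0$ (equivalently, at its cycle) is $(f^{\circ n})'(z_0)$, where $n$ is the period of $z_0$; it is the same at every point of the cycle. A cubic polynomial map with symmetries is a polynomial map $\mathbb{C} \to \mathbb{C}$ of degree $3$ that commutes (under composition) with some invertible affine map of $\mathbb{C}$ other than the identity. A polynomial map $f$ of degree $d \geq 2$ is a power map if it is affinely conjugate to $z \mapsto z^d$ (i.e. $\phi \circ f = g \circ \phi$ for some invertible affine map $\phi$, with $g(z) = z^d$). For $d \geq 2$, $T_d \in \mathbb{C}[z]$ denotes the unique polynomial such that $T_d(z + z^{-1}) = z^d + z^{-d}$. A polynomial map of degree $d \geq 2$ is a Chebyshev map if it is affinely conjugate to $T_d$ or to $-T_d$. *)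

theory Defs
  imports "HOL-Analysis.Analysis" "HOL-Computational_Algebra.Polynomial"
begin

definition polynomial_map :: "nat \<Rightarrow> (complex \<Rightarrow> complex) \<Rightarrow> bool" where
  "polynomial_map d f \<longleftrightarrow> (\<exists>p. degree p = d \<and> f = poly p)"

definition invertible_affine :: "(complex \<Rightarrow> complex) \<Rightarrow> bool" where
  "invertible_affine \<phi> \<longleftrightarrow> (\<exists>a b. a \<noteq> 0 \<and> \<phi> = (\<lambda>z. a * z + b))"

definition affinely_conjugate ::
    "(complex \<Rightarrow> complex) \<Rightarrow> (complex \<Rightarrow> complex) \<Rightarrow> bool" where
  "affinely_conjugate f g \<longleftrightarrow> (\<exists>\<phi>. invertible_affine \<phi> \<and> \<phi> \<circ> f = g \<circ> \<phi>)"

definition periodic_point :: "(complex \<Rightarrow> complex) \<Rightarrow> complex \<Rightarrow> bool" where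
  "periodic_point f z \<longleftrightarrow> (\<exists>n\<ge>1. (f ^^ n) z = z)"

definition period :: "(complex \<Rightarrow> complex) \<Rightarrow> complex \<Rightarrow> nat" where
  "period f z = (LEAST n. n \<ge> 1 \<and> (f ^^ n) z = z)"

text \<open>
  At a periodic point, this depends only on the cycle of that point, by the chain rule. Hence a
  condition on the multiplier at each cycle is expressed as a condition at each periodic point.
\<close>

definition multiplier :: "(complex \<Rightarrow> complex) \<Rightarrow> complex \<Rightarrow> complex" where
  "multiplier f z = deriv (f ^^ period f z) z"

definition cubic_with_symmetries :: "(complex \<Rightarrow> complex) \<Rightarrow> bool" where
  "cubic_with_symmetries f \<longleftrightarrow> polynomial_map 3 f \<and>
     (\<exists>\<phi>. invertible_affine \<phi> \<and> \<phi> \<noteq> id \<and> f \<circ> \<phi> = \<phi> \<circ> f)"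

definition power_map :: "(complex \<Rightarrow> complex) \<Rightarrow> bool" where
  "power_map f \<longleftrightarrow>
     (\<exists>d\<ge>2. polynomial_map d f \<and> affinely_conjugate f (\<lambda>z. z ^ d))"

text \<open>Normalised so that, for example, the polynomial of degree 2 is \<open>z\<^sup>2 - 2\<close>.\<close>

definition chebyshev_poly :: "nat \<Rightarrow> complex poly" where
  "chebyshev_poly d =
     (THE T. \<forall>z. z \<noteq> 0 \<longrightarrow> poly T (z + inverse z) = z ^ d + inverse z ^ d)"

definition chebyshev_map :: "(complex \<Rightarrow> complex) \<Rightarrow> bool" where
  "chebyshev_map f \<longleftrightarrow>
     (\<exists>d\<ge>2. polynomial_map d f \<and>
        (affinely_conjugate f (poly (chebyshev_poly d)) \<or>
         affinely_conjugate f (poly (- chebyshev_poly d))))"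

lemma chebyshev_poly_ex:
  "\<exists>T :: complex poly. \<forall>z. z \<noteq> 0 \<longrightarrow> poly T (z + inverse z) = z ^ d + inverse z ^ d"
proof (induction d rule: less_induct)
  case (less d)
  consider "d = 0" | "d = 1" | e where "d = Suc (Suc e)"
    by (metis One_nat_def not0_implies_Suc)
  then show ?case
  proof cases
    case 1
    then show ?thesis by (intro exI[of _ "[:2:]"]) simp
  next
    case 2
    then show ?thesis by (intro exI[of _ "[:0, 1:]"]) simp
  next
    case 3
    obtain T U :: "complex poly" where
      T: "\<And>z. z \<noteq> 0 \<Longrightarrow> poly T (z + inverse z) = z ^ e + inverse z ^ e" and
      U: "\<And>z. z \<noteq> 0 \<Longrightarrow> poly U (z + inverse z) = z ^ Suc e + inverse z ^ Suc e"
      using less.IH[of e] less.IH[of "Suc e"] 3 by auto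
    have "poly ([:0, 1:] * U - T) (z + inverse z) = z ^ d + inverse z ^ d" if "z \<noteq> 0" for z
    proof -
      have "poly ([:0, 1:] * U - T) (z + inverse z) =
          (z + inverse z) * (z * z ^ e + inverse z * inverse z ^ e) - (z ^ e + inverse z ^ e)"
        using T[OF that] U[OF that] by simp
      also have "\<dots> = z * z * z ^ e + inverse z * inverse z * inverse z ^ e
          + (z * inverse z - 1) * (z ^ e + inverse z ^ e)"
        by (simp add: algebra_simps)
      also have "\<dots> = z ^ d + inverse z ^ d"
        using that 3 by (simp add: mult.assoc)
      finally show ?thesis .
    qed
    then show ?thesis by blast
  qed
qed

lemma chebyshev_poly_unique:
  fixes T U :: "complex poly"
  assumes "\<forall>z. z \<noteq> 0 \<longrightarrow> poly T (z + inverse z) = z ^ d + inverse z ^ d"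
    and "\<forall>z. z \<noteq> 0 \<longrightarrow> poly U (z + inverse z) = z ^ d + inverse z ^ d"
  shows "T = U"
proof -
  have "poly T w = poly U w" for w
  proof -
    define s where "s = csqrt (w\<^sup>2 - 4)"
    define z where "z = (w + s) / 2"
    have "s * s = w\<^sup>2 - 4"
      unfolding s_def by (metis power2_csqrt power2_eq_square)
    then have m: "z * ((w - s) / 2) = 1"
      by (simp add: z_def field_simps power2_eq_square)
    then have z: "z \<noteq> 0"
      by (metis mult_zero_left zero_neq_one)
    from m have "inverse z = (w - s) / 2"
      by (rule inverse_unique)
    then have "z + inverse z = w"
      by (simp add: z_def field_simps)
    with assms z show ?thesis by metis
  qed
  then show ?thesis
    by (metis ext poly_eq_poly_eq_iff)
qed

lemma poly_chebyshev_poly: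
  assumes "z \<noteq> 0"
  shows "poly (chebyshev_poly d) (z + inverse z) = z ^ d + inverse z ^ d"
proof -
  have "\<exists>!T. \<forall>z. z \<noteq> 0 \<longrightarrow> poly T (z + inverse z) = z ^ d + inverse (z :: complex) ^ d"
    using chebyshev_poly_ex[of d] chebyshev_poly_unique[of _ d] by blast
  from theI'[OF this] show ?thesis
    using assms unfolding chebyshev_poly_def by blast
qed

end

theory Submission
  imports Defs
begin

text \<open>
  A cubic polynomial map with symmetries has the form \<open>f z = m + c (z - m)\<^sup>3 + a (z - m)\<close>, so it
  commutes with the point reflection in the fixed point \<open>m\<close>, whose multiplier is \<open>a\<close>; hence
  \<open>a\<close> is an integer. The solutions of \<open>f (f z) = 2 m - z\<close> other than \<open>m\<close> have period 4. Writing
  \<open>f z - m = t (z - m)\<close>, this equation becomes \<open>t\<^sup>4 - a t\<^sup>3 + a t + 1 = 0\<close>, which is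
  \<open>s\<^sup>2 - a s + 2 = 0\<close> in terms of \<open>s = t - 1 / t\<close>. The multiplier of the 4-cycle is
  \<open>(4 a\<^sup>2 - 9 - 6 a s)\<^sup>2\<close>, which is an integer plus \<open>-12 a (a\<^sup>2 - 9) s\<close>. So either
  \<open>a \<in> {0, 3, -3}\<close>, or \<open>s\<close> is rational. In the latter case the discriminant \<open>a\<^sup>2 - 8\<close> is a
  perfect square, which again forces \<open>a = 3\<close> or \<open>a = -3\<close>.
\<close>

lemma funpow_has_field_derivative:
  fixes f :: "complex \<Rightarrow> complex"
  assumes "\<And>z. (f has_field_derivative f' z) (at z)"
  shows "((f ^^ n) has_field_derivative (\<Prod>i<n. f' ((f ^^ i) z))) (at z)"
proof (induction n)
  case 0
  show ?case by (simp add: id_def)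
next
  case (Suc n)
  show ?case
    using DERIV_chain[OF assms Suc] by (simp add: mult.commute o_def)
qed

lemma multiplier_eq_prod:
  assumes "\<And>z. (f has_field_derivative f' z) (at z)" and "period f z = n"
  shows "multiplier f z = (\<Prod>i<n. f' ((f ^^ i) z))"
  unfolding multiplier_def assms(2)
  by (rule DERIV_imp_deriv[OF funpow_has_field_derivative[OF assms(1)]])

lemma period_fixed_point:
  assumes "f z = z"
  shows "period f z = 1"
  unfolding period_def using assms by (intro Least_equality) auto

text \<open>A period 1 or 2 would give \<open>f (f z) = z\<close>. A period 3 would give
  \<open>f z = z\<close> when combined with \<open>(f ^^ 4) z = z\<close>, so it is excluded
  too.\<close>

lemma period_eq_4:
  assumes "(f ^^ 4) z = z" and "f (f z) \<noteq> z"
  shows "period f z = 4"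
  unfolding period_def
proof (rule Least_equality)
  fix n :: nat
  assume n: "1 \<le> n \<and> (f ^^ n) z = z"
  show "4 \<le> n"
  proof (rule ccontr)
    assume "\<not> 4 \<le> n"
    with n consider "n = 1" | "n = 2" | "n = 3" by linarith
    then show False
      using n assms by cases (auto simp: eval_nat_numeral)
  qed
qed (use assms in simp)

lemma monic_quadratic_root:
  fixes b c :: complex
  obtains x where "x\<^sup>2 = b * x + c"
proof
  define r where "r = csqrt (b\<^sup>2 + 4 * c)"
  have "r\<^sup>2 = b\<^sup>2 + 4 * c" by (simp add: r_def)
  then show "((b + r) / 2)\<^sup>2 = b * ((b + r) / 2) + c"
    by (simp add: field_simps power2_eq_square)
qed

lemma cubic_with_symmetries_normal_form:
  assumes "cubic_with_symmetries f"
  obtains m c a where "c \<noteq> 0" and "f = (\<lambda>z. m + c * (z - m)^3 + a * (z - m))"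
proof -
  obtain p where p: "degree p = 3" "f = poly p"
    using assms by (auto simp: cubic_with_symmetries_def polynomial_map_def)
  obtain \<alpha> \<beta> where \<alpha>: "\<alpha> \<noteq> 0" and nontrivial: "(\<lambda>z. \<alpha> * z + \<beta>) \<noteq> id"
    and "f \<circ> (\<lambda>z. \<alpha> * z + \<beta>) = (\<lambda>z. \<alpha> * z + \<beta>) \<circ> f"
    using assms by (auto simp: cubic_with_symmetries_def invertible_affine_def)
  then have commute: "f (\<alpha> * z + \<beta>) = \<alpha> * f z + \<beta>" for z
    by (simp add: fun_eq_iff)
  define c0 c1 c2 c3 where c: "c0 = coeff p 0" "c1 = coeff p 1" "c2 = coeff p 2" "c3 = coeff p 3"
  have c3: "c3 \<noteq> 0"
    using p(1) by (metis c(4) degree_0 leading_coeff_0_iff zero_neq_numeral)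
  have f: "f z = c0 + c1 * z + c2 * z^2 + c3 * z^3" for z
    unfolding p(2) poly_altdef p(1) c by (simp add: eval_nat_numeral)
  \<comment> \<open>The coefficients of
    \<open>f (\<alpha> * z + \<beta>) - \<alpha> * f z - \<beta>\<close> as a polynomial in
    \<open>z\<close>.\<close>
  let ?q = "[:c0 + c1 * \<beta> + c2 * \<beta>^2 + c3 * \<beta>^3 - \<alpha> * c0 - \<beta>,
    c1 * \<alpha> + 2 * c2 * \<alpha> * \<beta> + 3 * c3 * \<alpha> * \<beta>^2 - \<alpha> * c1,
    c2 * \<alpha>^2 + 3 * c3 * \<alpha>^2 * \<beta> - \<alpha> * c2, c3 * \<alpha>^3 - \<alpha> * c3:]"
  have "poly ?q z = 0" for z
    using commute[of z] unfolding f by (simp add: algebra_simps power2_eq_square power3_eq_cube)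
  then have "?q = 0" using poly_all_0_iff_0 by blast
  then have q0: "c0 + c1 * \<beta> + c2 * \<beta>^2 + c3 * \<beta>^3 - \<alpha> * c0 - \<beta> = 0"
    and q2: "c2 * \<alpha>^2 + 3 * c3 * \<alpha>^2 * \<beta> - \<alpha> * c2 = 0" and q3: "c3 * \<alpha>^3 - \<alpha> * c3 = 0"
    by simp_all
  have "c3 * \<alpha> * (\<alpha>^2 - 1) = 0"
    using q3 by (simp add: algebra_simps power2_eq_square power3_eq_cube)
  then have "\<alpha>^2 = 1" using c3 \<alpha> by simp
  then have "\<alpha> = 1 \<or> \<alpha> = -1" by (simp add: power2_eq_1_iff)
  \<comment> \<open>For \<open>\<alpha> = 1\<close>, \<open>q2\<close> becomes
    \<open>3 * c3 * \<beta> = 0\<close>, so the symmetry would be the identity.\<close>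
  moreover have "\<alpha> \<noteq> 1"
    using q2 nontrivial c3 by (auto simp: id_def)
  ultimately have \<alpha>1: "\<alpha> = -1" by simp
  \<comment> \<open>The centre of the reflection that sends \<open>z\<close> to
    \<open>\<beta> - z\<close>.\<close>
  define m where "m = \<beta> / 2"
  have \<beta>: "\<beta> = 2 * m" by (simp add: m_def)
  have c2: "c2 = - (3 * c3 * m)"
    using q2 by (simp add: \<alpha>1 \<beta>) algebra
  have c0: "c0 = m - c1 * m + 2 * c3 * m^3"
    using q0 unfolding c2 \<alpha>1 \<beta> by algebra
  have "f = (\<lambda>z. m + c3 * (z - m)^3 + (c1 - 3 * c3 * m^2) * (z - m))"
    unfolding f c2 c0 fun_eq_iff by algebra
  with c3 that show ?thesis by blast
qed

text \<open>Gaps between consecutive squares grow: a larger square exceeds \<open>y * y\<close> by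
  at least \<open>2 * y + 1\<close>, so a difference of 8 forces \<open>y \<le> 3\<close> and leaves
  finitely many cases.\<close>

lemma square_minus_8_square:
  fixes a b :: int
  assumes "a\<^sup>2 - 8 = b\<^sup>2"
  shows "\<bar>a\<bar> = 3"
proof -
  define x y where xy: "x = \<bar>a\<bar>" "y = \<bar>b\<bar>"
  have nonneg: "0 \<le> x" "0 \<le> y" and eq: "x * x - y * y = 8"
    using assms by (simp_all add: xy power2_eq_square)
  then have "y\<^sup>2 < x\<^sup>2" by (simp add: power2_eq_square)
  then have "y < x" using nonneg(1) by (rule power_less_imp_less_base)
  then have "(y + 1) * (y + 1) \<le> x * x"
    using nonneg by (intro mult_mono) auto
  then have "y \<le> 3" using eq by (simp add: algebra_simps)
  then have "y \<in> {0, 1, 2, 3}" using nonneg by auto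
  moreover have "x \<le> 4"
    using eq nonneg \<open>y \<le> 3\<close> mult_mono[of y 3 y 3] mult_mono[of 5 x 5 x] by linarith
  then have "x \<in> {0, 1, 2, 3, 4}" using nonneg by auto
  ultimately show ?thesis using eq unfolding xy(1)[symmetric] by auto
qed

lemma integral_symmetric_4_cycle:
  fixes a :: int and s :: complex
  assumes s: "s\<^sup>2 = of_int a * s - 2"
    and integral: "(4 * (of_int a)\<^sup>2 - 9 - 6 * of_int a * s)\<^sup>2 \<in> \<int>"
  shows "a \<in> {0, 3, -3}"
proof (rule ccontr)
  assume contr: "a \<notin> {0, 3, -3}"
  define k where "k = 12 * a * (a\<^sup>2 - 9)"
  have "a\<^sup>2 \<noteq> 3\<^sup>2" using contr by (simp only: power2_eq_iff) auto
  then have k: "k \<noteq> 0" using contr by (simp add: k_def)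
  \<comment> \<open>Expand the square and replace its \<open>s\<^sup>2\<close> by
    \<open>a * s - 2\<close>; the part linear in \<open>s\<close> is then
    \<open>- k * s\<close>.\<close>
  have "of_int k * s = of_int ((4 * a\<^sup>2 - 9)\<^sup>2 - 72 * a\<^sup>2)
      - (4 * (of_int a)\<^sup>2 - 9 - 6 * of_int a * s)\<^sup>2"
    using s unfolding k_def by simp algebra
  then have "of_int k * s \<in> \<int>"
    using integral by (metis Ints_diff Ints_of_int)
  then obtain l where l: "of_int k * s = of_int l" by (auto elim: Ints_cases)
  \<comment> \<open>Here \<open>2 * l - a * k\<close> equals \<open>k * (2 * s - a)\<close>, and
    \<open>(2 * s - a)\<^sup>2\<close> is the discriminant \<open>a\<^sup>2 - 8\<close>.
    Divisibility by \<open>k\<close> then replaces rationality of \<open>s\<close>.\<close>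
  have "of_int ((2 * l - a * k)\<^sup>2) = (of_int (k\<^sup>2 * (a\<^sup>2 - 8)) :: complex)"
    using s by (simp add: l[symmetric]) algebra
  then have sq: "(2 * l - a * k)\<^sup>2 = k\<^sup>2 * (a\<^sup>2 - 8)" by (simp only: of_int_eq_iff)
  then have "k\<^sup>2 dvd (2 * l - a * k)\<^sup>2" by simp
  then have "k dvd 2 * l - a * k" by simp
  then obtain b where "2 * l - a * k = k * b" by (auto elim: dvdE)
  with sq k have "a\<^sup>2 - 8 = b\<^sup>2" by (simp add: power_mult_distrib)
  then have "\<bar>a\<bar> = 3" by (rule square_minus_8_square)
  with contr show False by auto
qed

lemma integer_multipliers_linear_coeff:
  fixes m c a :: complex
  defines "f \<equiv> \<lambda>z. m + c * (z - m)^3 + a * (z - m)"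
  assumes c: "c \<noteq> 0" and mult: "\<And>z. periodic_point f z \<Longrightarrow> multiplier f z \<in> \<int>"
  shows "a \<in> {0, 3, -3}"
proof -
  define f' where "f' = (\<lambda>z. 3 * (c * (z - m)^2) + a)"
  have deriv: "(f has_field_derivative f' z) (at z)" for z
    unfolding f_def f'_def by (auto intro!: derivative_eq_intros)
  have "f m = m" by (simp add: f_def)
  then have "multiplier f m = a"
    using multiplier_eq_prod[OF deriv period_fixed_point] by (simp add: f'_def)
  moreover have "periodic_point f m"
    unfolding periodic_point_def using \<open>f m = m\<close> by (intro exI[of _ 1]) simp
  ultimately obtain a' where a': "a = of_int a'"
    using mult by (metis Ints_cases)
  obtain s where s: "s\<^sup>2 = a * s + (- 2)" by (rule monic_quadratic_root)
  obtain t where t: "t\<^sup>2 = s * t + 1" by (rule monic_quadratic_root)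
  have t0: "t \<noteq> 0" using t by auto
  have st: "s = t - 1 / t" using t t0 by (simp add: field_simps power2_eq_square)
  have quartic: "t^4 - a * t^3 + a * t + 1 = 0" using s t by algebra
  \<comment> \<open>This makes \<open>x\<close> nonzero below, so that the cycle does not collapse
    to \<open>m\<close>. At \<open>t = a\<close> the quartic reduces to
    \<open>a\<^sup>2 + 1 = 0\<close>, impossible for an integer.\<close>
  have ta: "t \<noteq> a"
  proof
    assume "t = a"
    with quartic have "of_int (a'^2 + 1) = (0 :: complex)"
      by (simp add: a' power2_eq_square power3_eq_cube power4_eq_xxxx)
    then have "a'^2 + 1 = 0" by (simp only: of_int_eq_0_iff)
    then show False by (smt (verit) zero_le_power2)
  qed
  \<comment> \<open>Chosen so that \<open>f\<close> multiplies the offset \<open>x\<close> from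
    \<open>m\<close> by \<open>t\<close>. By the quartic, it multiplies the next offset
    \<open>t * x\<close> by \<open>- 1 / t\<close>, giving \<open>- x\<close>; symmetry about
    \<open>m\<close> closes the cycle.\<close>
  obtain x where "x\<^sup>2 = 0 * x + (t - a) / c" by (rule monic_quadratic_root)
  then have x: "c * x\<^sup>2 = t - a" using c by simp
  have x0: "x \<noteq> 0" using x ta by auto
  have y: "c * (t * x)\<^sup>2 = - 1 / t - a"
  proof -
    have "c * (t * x)\<^sup>2 = t\<^sup>2 * (t - a)" using x by algebra
    also have "\<dots> = - 1 / t - a" using quartic t0
      by (simp add: field_simps power2_eq_square power3_eq_cube power4_eq_xxxx)
    finally show ?thesis .
  qed
  have f_eq: "f (m + w) = m + (c * w\<^sup>2 + a) * w" for w
    unfolding f_def by (simp add: algebra_simps power2_eq_square power3_eq_cube)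
  have f1: "f (m + x) = m + t * x" unfolding f_eq x by simp
  have f2: "f (m + t * x) = m - x" unfolding f_eq y using t0 by simp
  have f3: "f (m - x) = m - t * x"
    using f_eq[of "- x"] x by simp
  have f4: "f (m - t * x) = m + x"
    using f_eq[of "- (t * x)"] y t0 by simp
  have iter: "(f ^^ 4) (m + x) = m + x"
    by (simp add: eval_nat_numeral f1 f2 f3 f4)
  have "m - x \<noteq> m + x" using x0 by (simp add: algebra_simps)
  then have "period f (m + x) = 4"
    using iter by (intro period_eq_4) (simp_all add: f1 f2)
  then have "multiplier f (m + x) = (\<Prod>i<4. f' ((f ^^ i) (m + x)))"
    by (rule multiplier_eq_prod[OF deriv])
  \<comment> \<open>\<open>f'\<close> is even about \<open>m\<close>, so opposite points of the
    cycle contribute equal factors.\<close>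
  also have "\<dots> = (f' (m + x) * f' (m + t * x))\<^sup>2"
    by (simp add: eval_nat_numeral f1 f2 f3 f'_def power_mult_distrib)
  also have "f' (m + x) * f' (m + t * x) = (3 * (t - a) + a) * (3 * (- 1 / t - a) + a)"
    using x y by (simp add: f'_def)
  also have "\<dots> = 4 * a\<^sup>2 - 9 - 6 * a * s"
    unfolding st using t0 by (simp add: field_simps power2_eq_square)
  finally have "multiplier f (m + x) = (4 * a\<^sup>2 - 9 - 6 * a * s)\<^sup>2" .
  moreover have "periodic_point f (m + x)"
    unfolding periodic_point_def using iter by (intro exI[of _ 4]) simp
  ultimately have "(4 * a\<^sup>2 - 9 - 6 * a * s)\<^sup>2 \<in> \<int>" using mult by metis
  then have "a' \<in> {0, 3, -3}"
    using s unfolding a' by (intro integral_symmetric_4_cycle) auto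
  then show ?thesis by (auto simp: a')
qed

lemma chebyshev_poly_3: "chebyshev_poly 3 = [:0, -3, 0, 1:]"
proof (rule chebyshev_poly_unique[of _ 3])
  show "\<forall>z. z \<noteq> 0 \<longrightarrow> poly [:0, -3, 0, 1:] (z + inverse z) = z ^ 3 + inverse (z::complex) ^ 3"
    by (simp add: field_simps power3_eq_cube)
qed (simp add: poly_chebyshev_poly)

text \<open>The conjugating map sends \<open>m + x\<close> to \<open>c * x\<close>, so it moves the
  centre \<open>m\<close> to 0 and leaves only the scale to choose.\<close>

lemma affinely_conjugateI:
  assumes "c \<noteq> 0" and "\<And>x. c * (f (m + x) - m) = g (c * x)"
  shows "affinely_conjugate f g"
  unfolding affinely_conjugate_def invertible_affine_def
proof (intro exI conjI)
  show "(\<lambda>z. c * z + (- c * m)) \<circ> f = g \<circ> (\<lambda>z. c * z + (- c * m))"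
    using assms(2)[of "z - m" for z] by (simp add: fun_eq_iff algebra_simps)
qed (use assms(1) in auto)

theorem theorem8:
  fixes f :: "complex \<Rightarrow> complex"
  assumes "cubic_with_symmetries f"
    and "\<And>z. periodic_point f z \<Longrightarrow> multiplier f z \<in> \<int>"
  shows "power_map f \<or> chebyshev_map f"
proof -
  obtain m c a where c: "c \<noteq> 0" and f: "f = (\<lambda>z. m + c * (z - m)^3 + a * (z - m))"
    using cubic_with_symmetries_normal_form[OF assms(1)] .
  have cubic: "polynomial_map 3 f"
    using assms(1) by (simp add: cubic_with_symmetries_def)
  define r where "r = csqrt c"
  have r: "r^2 = c" "r \<noteq> 0" using c by (auto simp: r_def)
  have "a \<in> {0, 3, -3}"
    using integer_multipliers_linear_coeff[OF c] assms(2) unfolding f by blast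
  then consider "a = 0" | "a = 3" | "a = -3" by auto
  then show ?thesis
  proof cases
    case 1
    have "affinely_conjugate f (\<lambda>z. z ^ 3)"
      using r(2) by (rule affinely_conjugateI[where m = m])
        (simp add: f 1 r(1)[symmetric] power2_eq_square power3_eq_cube)
    then have "power_map f"
      unfolding power_map_def using cubic by (intro exI[of _ 3]) simp
    then show ?thesis ..
  next
    case 2
    have "affinely_conjugate f (poly (- chebyshev_poly 3))"
    proof (rule affinely_conjugateI[where m = m])
      \<comment> \<open>The scale has square \<open>- c\<close>: the cubic term of
        \<open>- chebyshev_poly 3\<close> has coefficient -1, so the factor \<open>\<i>\<close>
        corrects the sign.\<close>
      show "\<i> * r \<noteq> 0" using r(2) by simp
    qed (simp add: f 2 r(1)[symmetric] chebyshev_poly_3 algebra_simps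
        power2_eq_square power3_eq_cube)
    then have "chebyshev_map f"
      unfolding chebyshev_map_def using cubic by (intro exI[of _ 3]) simp
    then show ?thesis ..
  next
    case 3
    have "affinely_conjugate f (poly (chebyshev_poly 3))"
      using r(2) by (rule affinely_conjugateI[where m = m])
        (simp add: f 3 r(1)[symmetric] chebyshev_poly_3 algebra_simps
          power2_eq_square power3_eq_cube)
    then have "chebyshev_map f"
      unfolding chebyshev_map_def using cubic by (intro exI[of _ 3]) simp
    then show ?thesis ..
  qed
qed

end
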